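(* Let $S$ and $S'$ be bounded $\vee$-semilattices. Then the map $$(G,G')\mapsto G\sqcup G'=\{[s,s']: s\in G\text{ or }s'\in G'\}$$ is a homeomorphism from $\widehat{S}\times\widehat{S'}$ (with the product topology) onto $\widehat{[S\times S']}$.
   Context: A $\vee$-semilattice is a non-empty poset in which any two elements $p,q$ have a supremum $p\vee q$; it is bounded if it has a minimum and a maximum. A grill in a $\vee$-semilattice $S$ is a subset $G\subseteq S$ such that $p\vee q\geq g\in G$ implies $p\in G$ or $q\in G$. The spectrum $\widehat{S}$ is the set of all proper minimal non-empty grills of $S$, i.e. grills $G$ with $\emptyset\neq G\neq S$ such that no non-empty grill is strictly contained in $G$. It carries the topology generated by the subbasis $(\widehat{S}_g)_{g\in S}$, where $\widehat{S}_g=\{G\in\widehat{S}:g\in G\}$. Given bounded $\vee$-semilattices $S,S'$ with minima $0,0'$ and maxima $1,1'$, let $1^\times=\{(s,s')\in S\times S': s=1\text{ or }s'=1'\}$. For $(s,s')\in S\times S'$ let $[s,s']=\{(s,s')\}$ if $(s,s')\notin 1^\times$ and $[s,s']=1^\times$ if $(s,s')\in1^\times$. Then $[S\times S']=\{[s,s']:s\in S,\ s'\in S'\}$ is a $\vee$-semilattice with join $[s,s']\vee[t,t']=[s\vee t,s'\vee t']$ (and order $x\leq y\Leftrightarrow x\vee y=y$). *)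

theory Defs
  imports "HOL-Analysis.Analysis" "HOL-Algebra.Lattice"
begin

locale bounded_upper_semilattice =
  upper_semilattice + weak_partial_order_bottom + weak_partial_order_top

section \<open>Grills and the spectrum\<close>

definition grill :: "('a, 'b) gorder_scheme \<Rightarrow> 'a set \<Rightarrow> bool" where
  "grill S G \<longleftrightarrow> G \<subseteq> carrier S \<and>
     (\<forall>p \<in> carrier S. \<forall>q \<in> carrier S. \<forall>g \<in> G. g \<sqsubseteq>\<^bsub>S\<^esub> p \<squnion>\<^bsub>S\<^esub> q \<longrightarrow> p \<in> G \<or> q \<in> G)"

definition spectrum :: "('a, 'b) gorder_scheme \<Rightarrow> 'a set set" where
  "spectrum S = {G. grill S G \<and> G \<noteq> {} \<and> G \<noteq> carrier S \<and>
     \<not> (\<exists>H. grill S H \<and> H \<noteq> {} \<and> H \<subset> G)}"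

definition spectrum_subbasic :: "('a, 'b) gorder_scheme \<Rightarrow> 'a \<Rightarrow> 'a set set" where
  "spectrum_subbasic S g = {G \<in> spectrum S. g \<in> G}"

definition spectrum_topology :: "('a, 'b) gorder_scheme \<Rightarrow> 'a set topology" where
  "spectrum_topology S = topology_generated_by (spectrum_subbasic S ` carrier S)"

text \<open>\<^const>\<open>topology_generated_by\<close> takes the union of the subbasis as the underlying space;
  as the members of the spectrum are non-empty, this is the whole spectrum.\<close>

lemma topspace_spectrum_topology [simp]: "topspace (spectrum_topology S) = spectrum S"
proof -
  have "(\<Union>g \<in> carrier S. spectrum_subbasic S g) = spectrum S"
  proof (intro equalityI subsetI)
    fix G assume G: "G \<in> spectrum S"
    then have "G \<subseteq> carrier S" "G \<noteq> {}"
      by (simp_all only: spectrum_def grill_def mem_Collect_eq simp_thms)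
    then obtain g where "g \<in> carrier S" "g \<in> G" by blast
    with G show "G \<in> (\<Union>g \<in> carrier S. spectrum_subbasic S g)"
      unfolding spectrum_subbasic_def by (intro UN_I[of g]) simp_all
  qed (simp add: spectrum_subbasic_def)
  then show ?thesis
    by (simp only: spectrum_topology_def topology_generated_by_topspace)
qed

section \<open>The product of bounded semilattices with identified top elements\<close>

definition top_cross :: "('a, 'c) gorder_scheme \<Rightarrow> ('b, 'd) gorder_scheme \<Rightarrow> ('a \<times> 'b) set" where
  "top_cross S T = {(s, t) \<in> carrier S \<times> carrier T. s = \<top>\<^bsub>S\<^esub> \<or> t = \<top>\<^bsub>T\<^esub>}"

definition pair_class ::
  "('a, 'c) gorder_scheme \<Rightarrow> ('b, 'd) gorder_scheme \<Rightarrow> 'a \<Rightarrow> 'b \<Rightarrow> ('a \<times> 'b) set" where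
  "pair_class S T s t = (if (s, t) \<in> top_cross S T then top_cross S T else {(s, t)})"

text \<open>The join \<open>[s, s'] \<squnion> [t, t'] = [s \<squnion> t, s' \<squnion> t']\<close> is
  defined through representatives: all the sets in the union below are equal
  (see \<open>pair_join_pair_class\<close>).\<close>

definition pair_join ::
  "('a, 'c) gorder_scheme \<Rightarrow> ('b, 'd) gorder_scheme \<Rightarrow>
    ('a \<times> 'b) set \<Rightarrow> ('a \<times> 'b) set \<Rightarrow> ('a \<times> 'b) set" where
  "pair_join S T X Y =
     (\<Union>(s, s') \<in> X. \<Union>(t, t') \<in> Y. pair_class S T (s \<squnion>\<^bsub>S\<^esub> t) (s' \<squnion>\<^bsub>T\<^esub> t'))"

definition pair_semilattice ::
  "('a, 'c) gorder_scheme \<Rightarrow> ('b, 'd) gorder_scheme \<Rightarrow> ('a \<times> 'b) set gorder" where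
  "pair_semilattice S T =
     \<lparr> carrier = {pair_class S T s t | s t. s \<in> carrier S \<and> t \<in> carrier T},
       eq = (=),
       le = (\<lambda>X Y. pair_join S T X Y = Y) \<rparr>"

definition grill_join ::
  "('a, 'c) gorder_scheme \<Rightarrow> ('b, 'd) gorder_scheme \<Rightarrow>
    'a set \<Rightarrow> 'b set \<Rightarrow> ('a \<times> 'b) set set" where
  "grill_join S T G H =
     {pair_class S T s t | s t. s \<in> carrier S \<and> t \<in> carrier T \<and> (s \<in> G \<or> t \<in> H)}"

section \<open>The product is a bounded semilattice with the intended join\<close>

context bounded_upper_semilattice
begin

lemma le_join_iff: "x \<in> carrier L \<Longrightarrow> y \<in> carrier L \<Longrightarrow> x \<sqsubseteq> y \<longleftrightarrow> x \<squnion> y = y"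
  using join_left[of x y] join_right[of x y] join_le[of x y y] join_closed[of x y]
    le_antisym[of "x \<squnion> y" y] le_refl[of y] by auto

lemma join_top_right: "x \<in> carrier L \<Longrightarrow> x \<squnion> \<top> = \<top>"
  using le_join_iff[of x \<top>] top_higher[of x] top_closed by simp

lemma join_top_left: "x \<in> carrier L \<Longrightarrow> \<top> \<squnion> x = \<top>"
  by (subst join_comm) (rule join_top_right)

lemma join_bottom_left: "x \<in> carrier L \<Longrightarrow> \<bottom> \<squnion> x = x"
  using le_join_iff[of \<bottom> x] bottom_lower[of x] bottom_closed by simp

lemma join_idem': "x \<in> carrier L \<Longrightarrow> x \<squnion> x = x"
  using le_join_iff[of x x] le_refl[of x] by simp

lemma join_assoc': "x \<in> carrier L \<Longrightarrow> y \<in> carrier L \<Longrightarrow> z \<in> carrier L \<Longrightarrow>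
    (x \<squnion> y) \<squnion> z = x \<squnion> (y \<squnion> z)"
  using weak_join_assoc[of x y z] by (simp add: eq_is_equal)

end

lemma top_cross_join:
  assumes "bounded_upper_semilattice S" "bounded_upper_semilattice T"
    and "(s, s') \<in> top_cross S T" "t \<in> carrier S" "t' \<in> carrier T"
  shows "(s \<squnion>\<^bsub>S\<^esub> t, s' \<squnion>\<^bsub>T\<^esub> t') \<in> top_cross S T" "(t \<squnion>\<^bsub>S\<^esub> s, t' \<squnion>\<^bsub>T\<^esub> s') \<in> top_cross S T"
proof -
  interpret S: bounded_upper_semilattice S by fact
  interpret T: bounded_upper_semilattice T by fact
  show "(s \<squnion>\<^bsub>S\<^esub> t, s' \<squnion>\<^bsub>T\<^esub> t') \<in> top_cross S T" "(t \<squnion>\<^bsub>S\<^esub> s, t' \<squnion>\<^bsub>T\<^esub> s') \<in> top_cross S T"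
    using assms(3-5) S.join_top_left S.join_top_right T.join_top_left T.join_top_right
    by (auto simp: top_cross_def)
qed

lemma pair_join_pair_class:
  assumes "bounded_upper_semilattice S" "bounded_upper_semilattice T"
    and "s \<in> carrier S" "t \<in> carrier S" "s' \<in> carrier T" "t' \<in> carrier T"
  shows "pair_join S T (pair_class S T s s') (pair_class S T t t')
    = pair_class S T (s \<squnion>\<^bsub>S\<^esub> t) (s' \<squnion>\<^bsub>T\<^esub> t')"
proof -
  have c: "u \<in> carrier S \<and> u' \<in> carrier T" if "(u, u') \<in> top_cross S T" for u u'
    using that by (auto simp: top_cross_def)
  have const: "pair_class S T (u \<squnion>\<^bsub>S\<^esub> v) (u' \<squnion>\<^bsub>T\<^esub> v') = pair_class S T (s \<squnion>\<^bsub>S\<^esub> t) (s' \<squnion>\<^bsub>T\<^esub> t')"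
    if "(u, u') \<in> pair_class S T s s'" "(v, v') \<in> pair_class S T t t'" for u u' v v'
  proof (cases "(s, s') \<in> top_cross S T \<or> (t, t') \<in> top_cross S T")
    case True
    have "u \<in> carrier S \<and> u' \<in> carrier T" "v \<in> carrier S \<and> v' \<in> carrier T"
      "(u, u') \<in> top_cross S T \<or> (v, v') \<in> top_cross S T"
      using that True c assms by (auto simp: pair_class_def split: if_splits)
    then have "(u \<squnion>\<^bsub>S\<^esub> v, u' \<squnion>\<^bsub>T\<^esub> v') \<in> top_cross S T" "(s \<squnion>\<^bsub>S\<^esub> t, s' \<squnion>\<^bsub>T\<^esub> t') \<in> top_cross S T"
      using top_cross_join[OF assms(1,2)] True assms by blast+
    then show ?thesis by (simp add: pair_class_def)
  next
    case False
    then show ?thesis using that by (simp add: pair_class_def)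
  qed
  have "(s, s') \<in> pair_class S T s s'" "(t, t') \<in> pair_class S T t t'"
    by (auto simp: pair_class_def)
  then have "(\<Union>(u, u') \<in> pair_class S T s s'. \<Union>(v, v') \<in> pair_class S T t t'.
      pair_class S T (u \<squnion>\<^bsub>S\<^esub> v) (u' \<squnion>\<^bsub>T\<^esub> v'))
    = (\<Union>_ \<in> pair_class S T s s'. \<Union>_ \<in> pair_class S T t t'.
      pair_class S T (s \<squnion>\<^bsub>S\<^esub> t) (s' \<squnion>\<^bsub>T\<^esub> t'))"
    by (intro SUP_cong refl) (clarify, intro SUP_cong refl, clarify, rule const)
  also have "\<dots> = pair_class S T (s \<squnion>\<^bsub>S\<^esub> t) (s' \<squnion>\<^bsub>T\<^esub> t')"
    using \<open>(s, s') \<in> _\<close> \<open>(t, t') \<in> _\<close> by auto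
  finally show ?thesis unfolding pair_join_def .
qed

theorem bounded_upper_semilattice_pair_semilattice:
  assumes "bounded_upper_semilattice S" "bounded_upper_semilattice T"
  shows "bounded_upper_semilattice (pair_semilattice S T)"
    and "\<lbrakk>s \<in> carrier S; t \<in> carrier S; s' \<in> carrier T; t' \<in> carrier T\<rbrakk> \<Longrightarrow>
      pair_class S T s s' \<squnion>\<^bsub>pair_semilattice S T\<^esub> pair_class S T t t'
        = pair_class S T (s \<squnion>\<^bsub>S\<^esub> t) (s' \<squnion>\<^bsub>T\<^esub> t')"
proof -
  interpret S: bounded_upper_semilattice S by fact
  interpret T: bounded_upper_semilattice T by fact
  let ?P = "pair_semilattice S T" and ?c = "pair_class S T" and ?j = "pair_join S T"
  note J = pair_join_pair_class[OF assms]
  have C: "carrier ?P = {?c s t | s t. s \<in> carrier S \<and> t \<in> carrier T}"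
    and E: "(.=\<^bsub>?P\<^esub>) = (=)" and LE: "\<And>X Y. X \<sqsubseteq>\<^bsub>?P\<^esub> Y \<longleftrightarrow> ?j X Y = Y"
    by (auto simp: pair_semilattice_def)
  have idem: "?j X X = X" if "X \<in> carrier ?P" for X
    using that by (auto simp: C J S.join_idem' T.join_idem')
  have comm: "?j X Y = ?j Y X" if "X \<in> carrier ?P" "Y \<in> carrier ?P" for X Y
    using that by (auto simp: C J join_comm)
  have closed: "?j X Y \<in> carrier ?P" if "X \<in> carrier ?P" "Y \<in> carrier ?P" for X Y
    using that unfolding C by (auto simp: J) (use S.join_closed T.join_closed in blast)
  have assoc: "?j (?j X Y) Z = ?j X (?j Y Z)"
    if "X \<in> carrier ?P" "Y \<in> carrier ?P" "Z \<in> carrier ?P" for X Y Z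
    using that by (auto simp: C J S.join_assoc' T.join_assoc')
  interpret P: partial_order ?P
  proof (unfold_locales)
    show "(.=\<^bsub>?P\<^esub>) = (=)" by (rule E)
  next
    fix X Y assume "X \<sqsubseteq>\<^bsub>?P\<^esub> Y" "Y \<sqsubseteq>\<^bsub>?P\<^esub> X" "X \<in> carrier ?P" "Y \<in> carrier ?P"
    then show "X .=\<^bsub>?P\<^esub> Y" unfolding LE E using comm by metis
  next
    fix X Y Z assume "X \<sqsubseteq>\<^bsub>?P\<^esub> Y" "Y \<sqsubseteq>\<^bsub>?P\<^esub> Z" "X \<in> carrier ?P" "Y \<in> carrier ?P" "Z \<in> carrier ?P"
    then show "X \<sqsubseteq>\<^bsub>?P\<^esub> Z" unfolding LE using assoc by metis
  qed (simp_all add: E LE idem)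
  have lub: "least ?P (?j X Y) (Upper ?P {X, Y})" if "X \<in> carrier ?P" "Y \<in> carrier ?P" for X Y
  proof -
    have "?j X (?j X Y) = ?j X Y" "?j Y (?j X Y) = ?j X Y"
      using that assoc idem comm by metis+
    moreover have "?j (?j X Y) Z = Z" if "?j X Z = Z" "?j Y Z = Z" "Z \<in> carrier ?P" for Z
      using that assoc[OF \<open>X \<in> _\<close> \<open>Y \<in> _\<close>] by simp
    ultimately show ?thesis
      using that closed by (auto simp: least_def Upper_def LE)
  qed
  interpret P: bounded_upper_semilattice ?P
  proof (unfold_locales)
    show "\<exists>s. least ?P s (Upper ?P {X, Y})" if "X \<in> carrier ?P" "Y \<in> carrier ?P" for X Y
      using lub that by blast
    have "\<forall>X \<in> carrier ?P. ?c \<bottom>\<^bsub>S\<^esub> \<bottom>\<^bsub>T\<^esub> \<sqsubseteq>\<^bsub>?P\<^esub> X"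
      by (auto simp: LE C J S.join_bottom_left T.join_bottom_left)
    moreover have "?c \<bottom>\<^bsub>S\<^esub> \<bottom>\<^bsub>T\<^esub> \<in> carrier ?P" unfolding C by blast
    ultimately show "\<exists>X. least ?P X (carrier ?P)" unfolding least_def by blast
    have "\<forall>X \<in> carrier ?P. X \<sqsubseteq>\<^bsub>?P\<^esub> ?c \<top>\<^bsub>S\<^esub> \<top>\<^bsub>T\<^esub>"
      by (auto simp: LE C J S.join_top_right T.join_top_right)
    moreover have "?c \<top>\<^bsub>S\<^esub> \<top>\<^bsub>T\<^esub> \<in> carrier ?P" unfolding C by blast
    ultimately show "\<exists>X. greatest ?P X (carrier ?P)" unfolding greatest_def by blast
  qed
  show "bounded_upper_semilattice ?P" by unfold_locales
  have "X \<squnion>\<^bsub>?P\<^esub> Y = ?j X Y" if "X \<in> carrier ?P" "Y \<in> carrier ?P" for X Y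
    using P.joinI[where P = "\<lambda>Z. Z = ?j X Y"] P.least_unique lub that by blast
  moreover have "?c u v \<in> carrier ?P" if "u \<in> carrier S" "v \<in> carrier T" for u v
    unfolding C using that by blast
  ultimately show "?c s s' \<squnion>\<^bsub>?P\<^esub> ?c t t' = ?c (s \<squnion>\<^bsub>S\<^esub> t) (s' \<squnion>\<^bsub>T\<^esub> t')"
    if "s \<in> carrier S" "t \<in> carrier S" "s' \<in> carrier T" "t' \<in> carrier T"
    using that by (simp add: J)
qed

end

theory Submission
  imports Defs
begin

text \<open>Complements of non-empty grills are the ideals that avoid the top element, so the spectrum
  consists of the complements of maximal ideals. Maximality of an ideal has the first-order form
  that every element outside it joins with some element inside it to the top; in this form it
  passes between \<open>G\<close>, \<open>G'\<close> and \<open>G \<squnion> G'\<close>, because \<open>[s, s'] = [s, 0'] \<squnion> [0, s']\<close> and \<open>[s, s']\<close> is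
  the top as soon as one coordinate is. The inverse map is
  \<open>K \<mapsto> ({s. [s, 0'] \<in> K}, {s'. [0, s'] \<in> K})\<close>.\<close>

section \<open>Grills as complements of ideals, and an elementwise form of minimality\<close>

context bounded_upper_semilattice
begin

text \<open>Upward closure is the defining condition with \<open>q = p\<close>, because
  \<open>p \<squnion> p = p\<close>; primeness is its case \<open>g = p \<squnion> q\<close>.
  Together the two give the condition back.\<close>

lemma grill_iff:
  "grill L G \<longleftrightarrow> G \<subseteq> carrier L \<and>
     (\<forall>g \<in> G. \<forall>p \<in> carrier L. g \<sqsubseteq> p \<longrightarrow> p \<in> G) \<and>
     (\<forall>p \<in> carrier L. \<forall>q \<in> carrier L. p \<squnion> q \<in> G \<longrightarrow> p \<in> G \<or> q \<in> G)"
proof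
  assume G: "grill L G"
  then have sub: "G \<subseteq> carrier L" by (simp add: grill_def)
  have "p \<in> G" if "g \<in> G" "p \<in> carrier L" "g \<sqsubseteq> p" for g p
    using G that join_idem'[of p] unfolding grill_def by metis
  moreover have "p \<in> G \<or> q \<in> G" if "p \<in> carrier L" "q \<in> carrier L" "p \<squnion> q \<in> G" for p q
    using G that join_closed le_refl unfolding grill_def by metis
  ultimately show "G \<subseteq> carrier L \<and>
     (\<forall>g \<in> G. \<forall>p \<in> carrier L. g \<sqsubseteq> p \<longrightarrow> p \<in> G) \<and>
     (\<forall>p \<in> carrier L. \<forall>q \<in> carrier L. p \<squnion> q \<in> G \<longrightarrow> p \<in> G \<or> q \<in> G)"
    using sub by blast
next
  assume "G \<subseteq> carrier L \<and>
     (\<forall>g \<in> G. \<forall>p \<in> carrier L. g \<sqsubseteq> p \<longrightarrow> p \<in> G) \<and>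
     (\<forall>p \<in> carrier L. \<forall>q \<in> carrier L. p \<squnion> q \<in> G \<longrightarrow> p \<in> G \<or> q \<in> G)"
  then show "grill L G"
    unfolding grill_def using join_closed by meson
qed

text \<open>Left to right is primeness, right to left is upward closure. Membership in a grill is
  thus a join homomorphism into the truth values; \<open>grillI\<close> is the converse.\<close>

lemma grill_join_iff:
  assumes "grill L G" "p \<in> carrier L" "q \<in> carrier L"
  shows "p \<squnion> q \<in> G \<longleftrightarrow> p \<in> G \<or> q \<in> G"
  using assms join_left[of p q] join_right[of p q] join_closed[of p q]
  unfolding grill_iff by blast

lemma grillI:
  assumes "G \<subseteq> carrier L"
    and "\<And>p q. p \<in> carrier L \<Longrightarrow> q \<in> carrier L \<Longrightarrow> p \<squnion> q \<in> G \<longleftrightarrow> p \<in> G \<or> q \<in> G"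
  shows "grill L G"
proof -
  \<comment> \<open>As \<open>g \<sqsubseteq> p\<close> means \<open>g \<squnion> p = p\<close>,
    upward closure is an instance of the join criterion.\<close>
  have "p \<in> G" if "g \<in> G" "p \<in> carrier L" "g \<sqsubseteq> p" for g p
    using assms(2)[of g p] assms(1) that le_join_iff[of g p] by auto
  then show ?thesis using assms by (simp add: grill_iff)
qed

lemma top_in_grill: "grill L G \<Longrightarrow> G \<noteq> {} \<Longrightarrow> \<top> \<in> G"
  unfolding grill_iff using top_higher top_closed by blast

lemma bottom_notin_grill: "grill L G \<Longrightarrow> G \<noteq> carrier L \<Longrightarrow> \<bottom> \<notin> G"
  unfolding grill_iff using bottom_lower by blast

text \<open>The set is the complement of the ideal generated by \<open>g\<close> and the complement
  of \<open>G\<close>. That ideal is closed under joins: bounds \<open>g \<squnion> h\<close> and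
  \<open>g \<squnion> k\<close> combine to \<open>g \<squnion> (h \<squnion> k)\<close>, and
  \<open>h \<squnion> k\<close> stays outside \<open>G\<close>.\<close>

lemma grill_outside_ideal:
  assumes G: "grill L G" and bot: "\<bottom> \<notin> G" and g: "g \<in> carrier L"
  shows "grill L {x \<in> carrier L. \<forall>h \<in> carrier L - G. \<not> x \<sqsubseteq> g \<squnion> h}" (is "grill L ?H")
proof -
  have "p \<in> ?H \<or> q \<in> ?H"
    if x: "x \<in> ?H" "x \<sqsubseteq> p \<squnion> q" and pq: "p \<in> carrier L" "q \<in> carrier L" for x p q
  proof (rule ccontr)
    assume "\<not> (p \<in> ?H \<or> q \<in> ?H)"
    then obtain h k where h: "h \<in> carrier L - G" "p \<sqsubseteq> g \<squnion> h" and k: "k \<in> carrier L - G" "q \<sqsubseteq> g \<squnion> k"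
      using pq by blast
    have hk: "h \<squnion> k \<in> carrier L - G"
      using grill_join_iff[OF G] h k by simp
    have "p \<squnion> (g \<squnion> (h \<squnion> k)) = g \<squnion> (h \<squnion> k)" "q \<squnion> (g \<squnion> (h \<squnion> k)) = g \<squnion> (h \<squnion> k)"
      using h k pq g le_join_iff join_assoc' join_comm join_closed by (smt (verit) Diff_iff)+
    then have "p \<squnion> q \<sqsubseteq> g \<squnion> (h \<squnion> k)"
      using pq g hk le_join_iff by (intro join_le) auto
    then have "x \<sqsubseteq> g \<squnion> (h \<squnion> k)"
      using x pq g hk le_trans by (smt (verit) Diff_iff join_closed mem_Collect_eq)
    then show False using x hk by blast
  qed
  then show ?thesis unfolding grill_def by blast
qed

text \<open>If some \<open>g\<close> in \<open>G\<close> had no complement outside \<open>G\<close>,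
  adding \<open>g\<close> to the ideal would still miss the top, and
  \<open>grill_outside_ideal\<close> would give a smaller non-empty grill. Conversely, if a
  non-empty grill \<open>H\<close> inside \<open>G\<close> misses \<open>g\<close>, a complement
  \<open>h\<close> of \<open>g\<close> outside \<open>G\<close> must lie in \<open>H\<close>, a
  contradiction.\<close>

lemma spectrum_iff:
  "G \<in> spectrum L \<longleftrightarrow> grill L G \<and> \<bottom> \<notin> G \<and> \<top> \<in> G \<and> (\<forall>g \<in> G. \<exists>h \<in> carrier L - G. g \<squnion> h = \<top>)"
proof
  assume "G \<in> spectrum L"
  then have G: "grill L G" "G \<noteq> {}" "G \<noteq> carrier L"
    and min: "\<And>H. grill L H \<Longrightarrow> H \<noteq> {} \<Longrightarrow> H \<subseteq> G \<Longrightarrow> H = G"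
    unfolding spectrum_def by blast+
  have sub: "G \<subseteq> carrier L" using G by (simp add: grill_def)
  note bot = bottom_notin_grill[OF G(1,3)] and top = top_in_grill[OF G(1,2)]
  have "\<exists>h \<in> carrier L - G. g \<squnion> h = \<top>" if "g \<in> G" for g
  proof (rule ccontr)
    assume none: "\<not> ?thesis"
    have g: "g \<in> carrier L" using that sub by blast
    let ?H = "{x \<in> carrier L. \<forall>h \<in> carrier L - G. \<not> x \<sqsubseteq> g \<squnion> h}"
    have "\<not> \<top> \<sqsubseteq> g \<squnion> h" if "h \<in> carrier L - G" for h
      using none that g le_join_iff[of \<top> "g \<squnion> h"] join_top_left[of "g \<squnion> h"] by auto
    then have "?H \<noteq> {}" using top_closed by blast
    \<comment> \<open>An \<open>x\<close> outside \<open>G\<close> could itself serve as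
      \<open>h\<close>, since \<open>x \<sqsubseteq> g \<squnion> x\<close>.\<close>
    moreover have "x \<in> G" if "x \<in> ?H" for x
      using that g join_right[of g x] by blast
    ultimately have "?H = G"
      using min[OF grill_outside_ideal[OF G(1) bot g]] by blast
    \<comment> \<open>Take \<open>h = \<bottom>\<close>, which lies outside
      \<open>G\<close>.\<close>
    moreover have "g \<notin> ?H"
      using join_left[of g \<bottom>] g bot bottom_closed by blast
    ultimately show False using that by blast
  qed
  with G bot top show "grill L G \<and> \<bottom> \<notin> G \<and> \<top> \<in> G \<and> (\<forall>g \<in> G. \<exists>h \<in> carrier L - G. g \<squnion> h = \<top>)"
    by blast
next
  assume *: "grill L G \<and> \<bottom> \<notin> G \<and> \<top> \<in> G \<and> (\<forall>g \<in> G. \<exists>h \<in> carrier L - G. g \<squnion> h = \<top>)"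
  have "\<not> H \<subset> G" if H: "grill L H" "H \<noteq> {}" for H
  proof
    assume "H \<subset> G"
    then obtain g where g: "g \<in> G" "g \<notin> H" by blast
    with * obtain h where h: "h \<in> carrier L - G" "g \<squnion> h = \<top>" by blast
    have "g \<in> carrier L" using * g by (auto simp: grill_def)
    then have "g \<in> H \<or> h \<in> H"
      using grill_join_iff[OF H(1), of g h] h top_in_grill[OF H] by auto
    then show False using g h \<open>H \<subset> G\<close> by blast
  qed
  then show "G \<in> spectrum L"
    unfolding spectrum_def using * bottom_closed by blast
qed

lemma spectrumI:
  assumes "grill L G" "\<bottom> \<notin> G" "\<top> \<in> G"
    and "\<And>g. g \<in> G \<Longrightarrow> \<exists>h \<in> carrier L - G. g \<squnion> h = \<top>"
  shows "G \<in> spectrum L"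
  using assms by (simp add: spectrum_iff)

lemma spectrumD:
  assumes "G \<in> spectrum L"
  shows "grill L G" "\<bottom> \<notin> G" "\<top> \<in> G" "G \<subseteq> carrier L"
    and "\<And>g. g \<in> G \<Longrightarrow> \<exists>h \<in> carrier L - G. g \<squnion> h = \<top>"
  using assms by (auto simp: spectrum_iff grill_def)

end

section \<open>Continuity of maps into a spectrum\<close>

lemma openin_spectrum_subbasic:
  "g \<in> carrier R \<Longrightarrow> openin (spectrum_topology R) (spectrum_subbasic R g)"
  unfolding spectrum_topology_def by (intro topology_generated_by_Basis) blast

text \<open>It suffices to test continuity on the subbasis, and the preimage of
  \<open>spectrum_subbasic R g\<close> is the set of points \<open>x\<close> with
  \<open>g \<in> f x\<close>.\<close>

lemma continuous_map_into_spectrum: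
  assumes "f \<in> topspace X \<rightarrow> spectrum R"
    and "\<And>g. g \<in> carrier R \<Longrightarrow> openin X {x \<in> topspace X. g \<in> f x}"
  shows "continuous_map X (spectrum_topology R) f"
proof -
  have "openin X (f -` U \<inter> topspace X)" if "U \<in> spectrum_subbasic R ` carrier R" for U
  proof -
    obtain g where g: "g \<in> carrier R" "U = spectrum_subbasic R g" using \<open>U \<in> _\<close> by blast
    have "f -` U \<inter> topspace X = {x \<in> topspace X. g \<in> f x}"
      using assms(1) unfolding g spectrum_subbasic_def by auto
    then show ?thesis using assms(2) g by simp
  qed
  \<comment> \<open>The criterion for generated topologies also asks that \<open>f\<close> map into
    the union of the subbasis; that union is the whole spectrum.\<close>
  moreover have "f \<in> topspace X \<rightarrow> \<Union> (spectrum_subbasic R ` carrier R)"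
    using assms(1) topspace_spectrum_topology[of R]
    by (simp add: spectrum_topology_def topology_generated_by_topspace)
  ultimately show ?thesis
    unfolding spectrum_topology_def by (intro continuous_on_generated_topo) auto
qed

section \<open>Calculation with classes in the product semilattice\<close>

locale bounded_upper_semilattice_pair =
  S: bounded_upper_semilattice S + T: bounded_upper_semilattice T
  for S :: "('a, 'c) gorder_scheme" and T :: "('b, 'd) gorder_scheme"
begin

text \<open>The facts about grills and spectra become available for the product as well as for both
  factors.\<close>

sublocale P: bounded_upper_semilattice "pair_semilattice S T"
  by (rule bounded_upper_semilattice_pair_semilattice) unfold_locales

abbreviation cls :: "'a \<Rightarrow> 'b \<Rightarrow> ('a \<times> 'b) set"
  where "cls \<equiv> pair_class S T"

text \<open>This is the preimage of \<open>K\<close> under the join-preserving map from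
  \<open>s\<close> to \<open>cls s \<bottom>\<close>; \<open>snd_trace\<close> is its mirror image.
  Pulling back in this way preserves the join criterion for grills.\<close>

definition fst_trace :: "('a \<times> 'b) set set \<Rightarrow> 'a set" where
  "fst_trace K = {s \<in> carrier S. cls s \<bottom>\<^bsub>T\<^esub> \<in> K}"

definition snd_trace :: "('a \<times> 'b) set set \<Rightarrow> 'b set" where
  "snd_trace K = {t \<in> carrier T. cls \<bottom>\<^bsub>S\<^esub> t \<in> K}"

lemma carrier_pair:
  "carrier (pair_semilattice S T) = {cls s t | s t. s \<in> carrier S \<and> t \<in> carrier T}"
  by (simp add: pair_semilattice_def)

lemma cls_closed [simp]:
  "s \<in> carrier S \<Longrightarrow> t \<in> carrier T \<Longrightarrow> cls s t \<in> carrier (pair_semilattice S T)"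
  unfolding carrier_pair by blast

lemma join_cls:
  "s \<in> carrier S \<Longrightarrow> u \<in> carrier S \<Longrightarrow> t \<in> carrier T \<Longrightarrow> v \<in> carrier T \<Longrightarrow>
    cls s t \<squnion>\<^bsub>pair_semilattice S T\<^esub> cls u v = cls (s \<squnion>\<^bsub>S\<^esub> u) (t \<squnion>\<^bsub>T\<^esub> v)"
  by (rule bounded_upper_semilattice_pair_semilattice(2)) unfold_locales

lemma cls_split:
  "s \<in> carrier S \<Longrightarrow> t \<in> carrier T \<Longrightarrow>
    cls s t = cls s \<bottom>\<^bsub>T\<^esub> \<squnion>\<^bsub>pair_semilattice S T\<^esub> cls \<bottom>\<^bsub>S\<^esub> t"
  using S.join_bottom_left[of s] T.join_bottom_left[of t]
  by (simp add: join_cls join_comm[of S s])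

lemma cls_eq_iff:
  assumes "s \<in> carrier S" "t \<in> carrier T" "u \<in> carrier S" "v \<in> carrier T"
  shows "cls s t = cls u v \<longleftrightarrow>
    s = u \<and> t = v \<or> (s = \<top>\<^bsub>S\<^esub> \<or> t = \<top>\<^bsub>T\<^esub>) \<and> (u = \<top>\<^bsub>S\<^esub> \<or> v = \<top>\<^bsub>T\<^esub>)"
  using assms unfolding pair_class_def top_cross_def by (auto split: if_splits)

lemma bottom_pair: "\<bottom>\<^bsub>pair_semilattice S T\<^esub> = cls \<bottom>\<^bsub>S\<^esub> \<bottom>\<^bsub>T\<^esub>"
proof -
  obtain s t where st: "s \<in> carrier S" "t \<in> carrier T" "\<bottom>\<^bsub>pair_semilattice S T\<^esub> = cls s t"
    using P.bottom_closed unfolding carrier_pair by blast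
  \<comment> \<open>The minimum is only known to be some class \<open>cls s t\<close>. Its join with
    the class of the two minima is computed twice: coordinatewise it is \<open>cls s t\<close>, and
    as a join with the minimum it is the class of the two minima.\<close>
  have "\<bottom>\<^bsub>pair_semilattice S T\<^esub> = cls s t \<squnion>\<^bsub>pair_semilattice S T\<^esub> cls \<bottom>\<^bsub>S\<^esub> \<bottom>\<^bsub>T\<^esub>"
    using st S.join_bottom_left[of s] T.join_bottom_left[of t]
    by (simp add: join_cls join_comm[of S s] join_comm[of T t])
  then show ?thesis using st P.join_bottom_left[of "cls \<bottom>\<^bsub>S\<^esub> \<bottom>\<^bsub>T\<^esub>"] by simp
qed

lemma cls_eq_top_iff:
  assumes "s \<in> carrier S" "t \<in> carrier T"
  shows "cls s t = \<top>\<^bsub>pair_semilattice S T\<^esub> \<longleftrightarrow> s = \<top>\<^bsub>S\<^esub> \<or> t = \<top>\<^bsub>T\<^esub>"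
proof -
  obtain u v where uv: "u \<in> carrier S" "v \<in> carrier T" "\<top>\<^bsub>pair_semilattice S T\<^esub> = cls u v"
    using P.top_closed unfolding carrier_pair by blast
  \<comment> \<open>As for the minimum, a join identifies the abstract top with the class of the two
    tops, which is the class collapsing \<open>top_cross\<close>.\<close>
  have "\<top>\<^bsub>pair_semilattice S T\<^esub> = cls u v \<squnion>\<^bsub>pair_semilattice S T\<^esub> cls \<top>\<^bsub>S\<^esub> \<top>\<^bsub>T\<^esub>"
    using uv P.join_top_left[of "cls \<top>\<^bsub>S\<^esub> \<top>\<^bsub>T\<^esub>"] by simp
  also have "\<dots> = cls \<top>\<^bsub>S\<^esub> \<top>\<^bsub>T\<^esub>"
    using uv by (simp add: join_cls S.join_top_right T.join_top_right)
  finally show ?thesis using assms by (auto simp: cls_eq_iff)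
qed

section \<open>The map from pairs of grills to grills of the product\<close>

lemma cls_in_grill_join_iff:
  assumes "\<top>\<^bsub>S\<^esub> \<in> G" "\<top>\<^bsub>T\<^esub> \<in> H" "s \<in> carrier S" "t \<in> carrier T"
  shows "cls s t \<in> grill_join S T G H \<longleftrightarrow> s \<in> G \<or> t \<in> H"
proof
  assume "cls s t \<in> grill_join S T G H"
  then obtain u v where "u \<in> carrier S" "v \<in> carrier T" "u \<in> G \<or> v \<in> H" "cls s t = cls u v"
    unfolding grill_join_def by blast
  \<comment> \<open>Representatives can differ only in the top class, and there one coordinate is a
    top, which lies in its grill. So the condition does not depend on the representative.\<close>
  then show "s \<in> G \<or> t \<in> H" using assms cls_eq_iff by metis
qed (use assms in \<open>auto simp: grill_join_def\<close>)

lemma grill_join_in_spectrum: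
  assumes G: "G \<in> spectrum S" and H: "H \<in> spectrum T"
  shows "grill_join S T G H \<in> spectrum (pair_semilattice S T)"
proof -
  note GD = S.spectrumD[OF G] and HD = T.spectrumD[OF H]
  note iff = cls_in_grill_join_iff[OF GD(3) HD(3)]
  have sub: "grill_join S T G H \<subseteq> carrier (pair_semilattice S T)"
    by (auto simp: grill_join_def)
  show ?thesis
  proof (rule P.spectrumI)
    show "grill (pair_semilattice S T) (grill_join S T G H)"
    proof (rule P.grillI[OF sub])
      fix X Y assume "X \<in> carrier (pair_semilattice S T)" "Y \<in> carrier (pair_semilattice S T)"
      then obtain s t u v where "s \<in> carrier S" "t \<in> carrier T" "u \<in> carrier S" "v \<in> carrier T"
        "X = cls s t" "Y = cls u v" unfolding carrier_pair by blast
      then show "X \<squnion>\<^bsub>pair_semilattice S T\<^esub> Y \<in> grill_join S T G H \<longleftrightarrow>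
          X \<in> grill_join S T G H \<or> Y \<in> grill_join S T G H"
        by (auto simp: join_cls iff S.grill_join_iff[OF GD(1)] T.grill_join_iff[OF HD(1)])
    qed
    show "\<bottom>\<^bsub>pair_semilattice S T\<^esub> \<notin> grill_join S T G H"
      using GD(2) HD(2) by (simp add: bottom_pair iff)
    show "\<top>\<^bsub>pair_semilattice S T\<^esub> \<in> grill_join S T G H"
      using GD(3) cls_eq_top_iff[of "\<top>\<^bsub>S\<^esub>" "\<top>\<^bsub>T\<^esub>"] iff[of "\<top>\<^bsub>S\<^esub>" "\<top>\<^bsub>T\<^esub>"] by simp
  next
    fix X assume "X \<in> grill_join S T G H"
    then obtain s t where X: "X = cls s t" and st: "s \<in> carrier S" "t \<in> carrier T" "s \<in> G \<or> t \<in> H"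
      unfolding grill_join_def by blast
    from st(3) show "\<exists>Y \<in> carrier (pair_semilattice S T) - grill_join S T G H.
        X \<squnion>\<^bsub>pair_semilattice S T\<^esub> Y = \<top>\<^bsub>pair_semilattice S T\<^esub>"
    proof
      assume "s \<in> G"
      then obtain h where "h \<in> carrier S" "h \<notin> G" "s \<squnion>\<^bsub>S\<^esub> h = \<top>\<^bsub>S\<^esub>" using GD(5) by blast
      \<comment> \<open>The complement \<open>h\<close> of \<open>s\<close> is paired with the
        minimum of \<open>T\<close>: neither coordinate lies in its grill, so the class is outside,
        and one top coordinate suffices to make the join the top.\<close>
      then show ?thesis using st HD(2)
        by (intro bexI[of _ "cls h \<bottom>\<^bsub>T\<^esub>"]) (auto simp: X join_cls iff cls_eq_top_iff)
    next
      assume "t \<in> H"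
      then obtain h where "h \<in> carrier T" "h \<notin> H" "t \<squnion>\<^bsub>T\<^esub> h = \<top>\<^bsub>T\<^esub>" using HD(5) by blast
      then show ?thesis using st GD(2)
        by (intro bexI[of _ "cls \<bottom>\<^bsub>S\<^esub> h"]) (auto simp: X join_cls iff cls_eq_top_iff)
    qed
  qed
qed

section \<open>Traces of a product grill and the inverse map\<close>

lemma cls_in_grill_iff:
  assumes "grill (pair_semilattice S T) K" "s \<in> carrier S" "t \<in> carrier T"
  shows "cls s t \<in> K \<longleftrightarrow> s \<in> fst_trace K \<or> t \<in> snd_trace K"
proof -
  \<comment> \<open>Splitting the class and applying primeness and upward closure of
    \<open>K\<close> reduces membership to classes with one minimal coordinate; hence a grill is
    determined by its two traces.\<close>
  have "cls s t \<in> K \<longleftrightarrow> cls s \<bottom>\<^bsub>T\<^esub> \<in> K \<or> cls \<bottom>\<^bsub>S\<^esub> t \<in> K"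
    unfolding cls_split[OF assms(2,3)] using assms by (intro P.grill_join_iff) auto
  then show ?thesis using assms by (simp add: fst_trace_def snd_trace_def)
qed

lemma top_in_traces:
  assumes "K \<in> spectrum (pair_semilattice S T)"
  shows "\<top>\<^bsub>S\<^esub> \<in> fst_trace K" "\<top>\<^bsub>T\<^esub> \<in> snd_trace K"
  using P.spectrumD(3)[OF assms] cls_eq_top_iff[of "\<top>\<^bsub>S\<^esub>" "\<bottom>\<^bsub>T\<^esub>"] cls_eq_top_iff[of "\<bottom>\<^bsub>S\<^esub>" "\<top>\<^bsub>T\<^esub>"]
  by (simp_all add: fst_trace_def snd_trace_def)

text \<open>The grill properties pull back; the substance is finding complements. A complement of
  \<open>cls g \<bottom>\<close> outside \<open>K\<close> is represented by a pair
  \<open>(u, v)\<close>, and \<open>u\<close> turns out to be a complement of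
  \<open>g\<close>.\<close>

lemma traces_in_spectrum:
  assumes K: "K \<in> spectrum (pair_semilattice S T)"
  shows "fst_trace K \<in> spectrum S" "snd_trace K \<in> spectrum T"
proof -
  note KD = P.spectrumD[OF K] and tops = top_in_traces[OF K]
  note iff = cls_in_grill_iff[OF KD(1)] and join = P.grill_join_iff[OF KD(1)]
  have compl: "\<exists>u v. u \<in> carrier S - fst_trace K \<and> v \<in> carrier T - snd_trace K \<and>
      (s \<squnion>\<^bsub>S\<^esub> u = \<top>\<^bsub>S\<^esub> \<or> t \<squnion>\<^bsub>T\<^esub> v = \<top>\<^bsub>T\<^esub>)"
    if st: "s \<in> carrier S" "t \<in> carrier T" "cls s t \<in> K" for s t
  proof -
    obtain Y where Y: "Y \<in> carrier (pair_semilattice S T) - K"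
      "cls s t \<squnion>\<^bsub>pair_semilattice S T\<^esub> Y = \<top>\<^bsub>pair_semilattice S T\<^esub>"
      using KD(5) st by blast
    then obtain u v where "u \<in> carrier S" "v \<in> carrier T" "Y = cls u v"
      unfolding carrier_pair by blast
    \<comment> \<open>A class lies outside \<open>K\<close> exactly if both coordinates lie outside
      the traces, and it is the top exactly if one coordinate is.\<close>
    then show ?thesis using Y st iff by (auto simp: join_cls cls_eq_top_iff)
  qed
  show "fst_trace K \<in> spectrum S"
  proof (rule S.spectrumI)
    show "grill S (fst_trace K)"
    proof (rule S.grillI)
      fix p q assume "p \<in> carrier S" "q \<in> carrier S"
      then show "p \<squnion>\<^bsub>S\<^esub> q \<in> fst_trace K \<longleftrightarrow> p \<in> fst_trace K \<or> q \<in> fst_trace K"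
        using join[of "cls p \<bottom>\<^bsub>T\<^esub>" "cls q \<bottom>\<^bsub>T\<^esub>"]
        by (simp add: fst_trace_def join_cls T.join_idem')
    qed (auto simp: fst_trace_def)
    show "\<bottom>\<^bsub>S\<^esub> \<notin> fst_trace K" using KD(2) by (simp add: fst_trace_def bottom_pair)
  next
    fix g assume "g \<in> fst_trace K"
    then obtain u v where "u \<in> carrier S - fst_trace K" "v \<in> carrier T - snd_trace K"
      "g \<squnion>\<^bsub>S\<^esub> u = \<top>\<^bsub>S\<^esub> \<or> \<bottom>\<^bsub>T\<^esub> \<squnion>\<^bsub>T\<^esub> v = \<top>\<^bsub>T\<^esub>"
      using compl[of g "\<bottom>\<^bsub>T\<^esub>"] by (auto simp: fst_trace_def)
    \<comment> \<open>The second alternative would make \<open>v\<close> the top of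
      \<open>T\<close>, but the top lies in \<open>snd_trace K\<close> and \<open>v\<close> does
      not.\<close>
    then show "\<exists>h \<in> carrier S - fst_trace K. g \<squnion>\<^bsub>S\<^esub> h = \<top>\<^bsub>S\<^esub>"
      using tops(2) by (auto simp: T.join_bottom_left)
  qed (rule tops)
  show "snd_trace K \<in> spectrum T"
  proof (rule T.spectrumI)
    show "grill T (snd_trace K)"
    proof (rule T.grillI)
      fix p q assume "p \<in> carrier T" "q \<in> carrier T"
      then show "p \<squnion>\<^bsub>T\<^esub> q \<in> snd_trace K \<longleftrightarrow> p \<in> snd_trace K \<or> q \<in> snd_trace K"
        using join[of "cls \<bottom>\<^bsub>S\<^esub> p" "cls \<bottom>\<^bsub>S\<^esub> q"]
        by (simp add: snd_trace_def join_cls S.join_idem')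
    qed (auto simp: snd_trace_def)
    show "\<bottom>\<^bsub>T\<^esub> \<notin> snd_trace K" using KD(2) by (simp add: snd_trace_def bottom_pair)
  next
    fix g assume "g \<in> snd_trace K"
    then obtain u v where "u \<in> carrier S - fst_trace K" "v \<in> carrier T - snd_trace K"
      "\<bottom>\<^bsub>S\<^esub> \<squnion>\<^bsub>S\<^esub> u = \<top>\<^bsub>S\<^esub> \<or> g \<squnion>\<^bsub>T\<^esub> v = \<top>\<^bsub>T\<^esub>"
      using compl[of "\<bottom>\<^bsub>S\<^esub>" g] by (auto simp: snd_trace_def)
    then show "\<exists>h \<in> carrier T - snd_trace K. g \<squnion>\<^bsub>T\<^esub> h = \<top>\<^bsub>T\<^esub>"
      using tops(1) by (auto simp: S.join_bottom_left)
  qed (rule tops)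
qed

lemma grill_join_traces:
  assumes K: "K \<in> spectrum (pair_semilattice S T)"
  shows "grill_join S T (fst_trace K) (snd_trace K) = K"
proof -
  note KD = P.spectrumD[OF K]
  show ?thesis
    using KD(4) cls_in_grill_iff[OF KD(1)] unfolding grill_join_def carrier_pair by blast
qed

text \<open>With the minimum in one coordinate, the disjunction defining \<open>grill_join\<close>
  reduces to the other coordinate, since no member of a spectrum contains the minimum.\<close>

lemma traces_grill_join:
  assumes "G \<in> spectrum S" "H \<in> spectrum T"
  shows "fst_trace (grill_join S T G H) = G" "snd_trace (grill_join S T G H) = H"
  using S.spectrumD[OF assms(1)] T.spectrumD[OF assms(2)]
  by (auto simp: fst_trace_def snd_trace_def cls_in_grill_join_iff)

section \<open>Continuity in both directions and the homeomorphism\<close>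

lemma continuous_map_grill_join:
  "continuous_map (prod_topology (spectrum_topology S) (spectrum_topology T))
     (spectrum_topology (pair_semilattice S T)) (\<lambda>(G, H). grill_join S T G H)"
proof (rule continuous_map_into_spectrum)
  fix X assume "X \<in> carrier (pair_semilattice S T)"
  then obtain s t where X: "s \<in> carrier S" "t \<in> carrier T" "X = cls s t"
    unfolding carrier_pair by blast
  let ?Q = "prod_topology (spectrum_topology S) (spectrum_topology T)"
  \<comment> \<open>The disjunction describing membership of \<open>cls s t\<close> turns the
    preimage of a subbasic set into a union of two open cylinders.\<close>
  have "{x \<in> topspace ?Q. X \<in> (\<lambda>(G, H). grill_join S T G H) x}
      = spectrum_subbasic S s \<times> spectrum T \<union> spectrum S \<times> spectrum_subbasic T t"
    using X by (auto simp: spectrum_subbasic_def cls_in_grill_join_iff S.spectrumD(3) T.spectrumD(3))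
  moreover have "openin ?Q \<dots>"
    using X openin_spectrum_subbasic[of s S] openin_spectrum_subbasic[of t T]
      openin_topspace[of "spectrum_topology S"] openin_topspace[of "spectrum_topology T"]
    by (intro openin_Un) (simp_all add: openin_prod_Times_iff)
  ultimately show "openin ?Q {x \<in> topspace ?Q. X \<in> (\<lambda>(G, H). grill_join S T G H) x}"
    by simp
qed (auto intro: grill_join_in_spectrum)

text \<open>The preimage of the subbasic set at \<open>s\<close> is the subbasic set at
  \<open>cls s \<bottom>\<close>, and symmetrically for \<open>t\<close>.\<close>

lemma continuous_map_traces:
  "continuous_map (spectrum_topology (pair_semilattice S T)) (spectrum_topology S) fst_trace"
  "continuous_map (spectrum_topology (pair_semilattice S T)) (spectrum_topology T) snd_trace"
proof -
  let ?X = "spectrum_topology (pair_semilattice S T)"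
  show "continuous_map ?X (spectrum_topology S) fst_trace"
  proof (rule continuous_map_into_spectrum)
    fix s assume "s \<in> carrier S"
    then show "openin ?X {K \<in> topspace ?X. s \<in> fst_trace K}"
      using openin_spectrum_subbasic[of "cls s \<bottom>\<^bsub>T\<^esub>" "pair_semilattice S T"]
      by (simp add: fst_trace_def spectrum_subbasic_def)
  qed (auto intro: traces_in_spectrum)
  show "continuous_map ?X (spectrum_topology T) snd_trace"
  proof (rule continuous_map_into_spectrum)
    fix t assume "t \<in> carrier T"
    then show "openin ?X {K \<in> topspace ?X. t \<in> snd_trace K}"
      using openin_spectrum_subbasic[of "cls \<bottom>\<^bsub>S\<^esub> t" "pair_semilattice S T"]
      by (simp add: snd_trace_def spectrum_subbasic_def)
  qed (auto intro: traces_in_spectrum)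
qed

lemma homeomorphic_maps_grill_join:
  "homeomorphic_maps
     (prod_topology (spectrum_topology S) (spectrum_topology T))
     (spectrum_topology (pair_semilattice S T))
     (\<lambda>(G, H). grill_join S T G H) (\<lambda>K. (fst_trace K, snd_trace K))"
  unfolding homeomorphic_maps_def
  by (auto simp: continuous_map_grill_join continuous_map_paired continuous_map_traces
      grill_join_traces traces_grill_join)

end

theorem theorem3p1:
  fixes S :: "('a, 'c) gorder_scheme" and S' :: "('b, 'd) gorder_scheme"
  assumes "bounded_upper_semilattice S" and "bounded_upper_semilattice S'"
  shows "homeomorphic_map
           (prod_topology (spectrum_topology S) (spectrum_topology S'))
           (spectrum_topology (pair_semilattice S S'))
           (\<lambda>(G, G'). grill_join S S' G G')"
proof -
  interpret bounded_upper_semilattice_pair S S'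
    using assms by (rule bounded_upper_semilattice_pair.intro)
  show ?thesis
    using homeomorphic_maps_grill_join homeomorphic_map_maps by blast
qed

end
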